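(* For all positive integers $n$ and all integers $t$ with $3\le t\le n$, there exists no $t$-balanced code $\mathcal{C}\subseteq\mathbb{S}_n$.
   Context: $\mathbb{S}_n$ is the group of permutations of $[n]=\{1,\dots,n\}$, written in one-line notation. The Kendall-$\tau$ distance $\mathrm{d}_\mathrm{K}(\sigma,\tau)$ is the minimum number of adjacent transpositions (swaps of two consecutive entries in one-line notation) needed to obtain $\sigma$ from $\tau$. A code is a subset $\mathcal{C}\subseteq\mathbb{S}_n$ with $|\mathcal{C}|\ge2$, with minimum distance $\mathrm{d}_\mathrm{K}(\mathcal{C})=\min\{\mathrm{d}_\mathrm{K}(\sigma,\tau):\sigma\ne\tau\in\mathcal{C}\}$. A code $\mathcal{C}\subseteq\mathbb{S}_n$ is $t$-balanced if $\mathrm{d}_\mathrm{K}(\mathcal{C})>\binom{t}{2}$ and $|\mathcal{C}|=n!/t!$. *)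

theory Defs
  imports Complex_Main "HOL-Combinatorics.Permutations"
begin

text \<open>A permutation \<open>\<sigma>\<close> of \<open>{1..n}\<close> has one-line notation \<open>\<sigma> 1, \<dots>, \<sigma> n\<close>, so swapping the entries
  in positions \<open>i\<close> and \<open>i + 1\<close> is composition with a transposition on the right.\<close>

definition adjacent_swap :: "nat \<Rightarrow> ((nat \<Rightarrow> nat) \<times> (nat \<Rightarrow> nat)) set" where
  "adjacent_swap n =
     {(\<tau>, \<sigma>). \<tau> permutes {1..n} \<and> (\<exists>i\<in>{1..<n}. \<sigma> = \<tau> \<circ> transpose i (i + 1))}"

definition kendall_dist :: "nat \<Rightarrow> (nat \<Rightarrow> nat) \<Rightarrow> (nat \<Rightarrow> nat) \<Rightarrow> nat" where
  "kendall_dist n \<sigma> \<tau> = (LEAST k. (\<tau>, \<sigma>) \<in> adjacent_swap n ^^ k)"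

definition permutation_code :: "nat \<Rightarrow> (nat \<Rightarrow> nat) set \<Rightarrow> bool" where
  "permutation_code n C \<longleftrightarrow> C \<subseteq> {\<sigma>. \<sigma> permutes {1..n}} \<and> card C \<ge> 2"

definition kendall_min_dist :: "nat \<Rightarrow> (nat \<Rightarrow> nat) set \<Rightarrow> nat" where
  "kendall_min_dist n C = Min {kendall_dist n \<sigma> \<tau> | \<sigma> \<tau>. \<sigma> \<in> C \<and> \<tau> \<in> C \<and> \<sigma> \<noteq> \<tau>}"

definition balanced_code :: "nat \<Rightarrow> nat \<Rightarrow> (nat \<Rightarrow> nat) set \<Rightarrow> bool" where
  "balanced_code n t C \<longleftrightarrow>
     permutation_code n C \<and> kendall_min_dist n C > t choose 2 \<and>
     real (card C) = fact n / fact t"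

end

theory Submission
  imports Defs
begin

text \<open>The Kendall distance of two permutations is at most the number of pairs of entries they order
  differently (bubble sort). By averaging over the cosets of the group permuting the first
  \<open>t + 1\<close> positions, a code of size \<open>n! / t!\<close> has \<open>t + 1\<close> words in one coset, and these differ by
  permutations of \<open>{1..t + 1}\<close> which pairwise disagree on more than \<open>t choose 2\<close> pairs. Double
  counting the disagreements (a Plotkin bound) gives \<open>4 * ((t choose 2) + 1) \<le> (t + 1)\<^sup>2\<close>, hence
  \<open>t \<le> 3\<close>. If \<open>t = 3\<close>, measure three of the four permutations against the fourth: the sets of
  pairs on which they agree with it have at most two elements and are pairwise disjoint, so they
  partition the six pairs. One of them contains the pair of the first and the last element, and
  transitivity forces two more pairs into it.\<close>

section \<open>Discordant pairs and the Kendall distance\<close>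

text \<open>For injective \<open>p\<close> and \<open>q\<close>, each unordered pair on which they
  disagree occurs once, oriented as \<open>p\<close> orders it. For words the arguments are
  inverses, since \<open>inv \<sigma> x\<close> is the position of the entry
  \<open>x\<close>.\<close>

definition discordant ::
    "'a set \<Rightarrow> ('a \<Rightarrow> 'b::linorder) \<Rightarrow> ('a \<Rightarrow> 'b) \<Rightarrow> ('a \<times> 'a) set" where
  "discordant A p q = {(x, y) \<in> A \<times> A. p x < p y \<and> q y < q x}"

lemma finite_discordant [simp]: "finite A \<Longrightarrow> finite (discordant A p q)"
  unfolding discordant_def by (rule finite_subset[of _ "A \<times> A"]) auto

text \<open>Injectivity makes the steps strict, so \<open>i \<le> p i\<close> by induction. Used in
  contrapositive form: a non-identity permutation has a descent at two neighbouring
  positions.\<close>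

lemma permutes_mono_imp_id:
  fixes n :: nat
  assumes p: "p permutes {1..n}" and mono: "\<And>i. i \<in> {1..<n} \<Longrightarrow> p i \<le> p (i + 1)"
  shows "p = id"
proof -
  have less: "p i < p (Suc i)" if "1 \<le> i" "i < n" for i
    using mono[of i] that inj_eq[OF permutes_inj[OF p], of i "Suc i"] by simp
  have ge: "i \<le> n \<Longrightarrow> i \<le> p i" for i
  proof (induction i)
    case (Suc i)
    show ?case
    proof (cases "i = 0")
      case True
      then have "p (Suc i) \<in> {1..n}"
        using Suc.prems permutes_in_image[OF p, of "Suc i"] by auto
      then show ?thesis using True by simp
    next
      case False
      then show ?thesis using less[of i] Suc by simp
    qed
  qed simp
  then show ?thesis
    using permutes_natset_ge[OF p] by simp
qed

text \<open>Unless \<open>\<tau> = \<sigma>\<close>, some two neighbouring entries of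
  \<open>\<tau>\<close> stand in the opposite order in \<open>\<sigma>\<close>. Swapping them
  removes their pair from the discordant set and creates no new one, so induction on its size
  applies.\<close>

lemma relpow_adjacent_swap_discordant:
  assumes \<sigma>: "\<sigma> permutes {1..n}" and \<tau>: "\<tau> permutes {1..n}"
  shows "\<exists>k \<le> card (discordant {1..n} (inv \<sigma>) (inv \<tau>)). (\<tau>, \<sigma>) \<in> adjacent_swap n ^^ k"
  using \<tau>
proof (induction "card (discordant {1..n} (inv \<sigma>) (inv \<tau>))" arbitrary: \<tau> rule: less_induct)
  case less
  note \<tau> = less.prems
  show ?case
  proof (cases "\<tau> = \<sigma>")
    case True
    then show ?thesis by (intro exI[of _ 0]) simp
  next
    case False
    have "inv \<sigma> \<circ> \<tau> \<noteq> id"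
    proof
      assume "inv \<sigma> \<circ> \<tau> = id"
      then have "\<sigma> \<circ> (inv \<sigma> \<circ> \<tau>) = \<sigma>" by simp
      then show False using False permutes_inv_o(1)[OF \<sigma>] by (simp flip: comp_assoc)
    qed
    then obtain i where i: "i \<in> {1..<n}" and gt: "inv \<sigma> (\<tau> (i + 1)) < inv \<sigma> (\<tau> i)"
      using permutes_mono_imp_id[OF permutes_compose[OF \<tau> permutes_inv[OF \<sigma>]]]
      by (metis comp_apply not_le)
    define s where "s = transpose i (i + 1)"
    define \<tau>' where "\<tau>' = \<tau> \<circ> s"
    have s: "s permutes {1..n}"
      unfolding s_def by (rule permutes_swap_id) (use i in auto)
    have \<tau>': "\<tau>' permutes {1..n}"
      unfolding \<tau>'_def by (rule permutes_compose[OF s \<tau>])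
    have inv\<tau>': "inv \<tau>' x = s (inv \<tau> x)" for x
      unfolding \<tau>'_def using permutes_bij[OF s] permutes_bij[OF \<tau>]
      by (simp add: o_inv_distrib s_def)
    have inv\<tau>: "inv \<tau> (\<tau> x) = x" "\<tau> (inv \<tau> x) = x" for x
      using permutes_inverses[OF \<tau>] by auto
    let ?D = "discordant {1..n} (inv \<sigma>) (inv \<tau>)"
    let ?D' = "discordant {1..n} (inv \<sigma>) (inv \<tau>')"
    have "(\<tau> (i + 1), \<tau> i) \<in> ?D"
      using i gt permutes_in_image[OF \<tau>] by (auto simp: discordant_def inv\<tau>)
    moreover have "(\<tau> (i + 1), \<tau> i) \<notin> ?D'"
      by (auto simp: discordant_def inv\<tau>' inv\<tau> s_def)
    moreover have "?D' \<subseteq> ?D"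
    proof clarify
      fix x y assume xy: "(x, y) \<in> ?D'"
      have sxy: "s (inv \<tau> y) < s (inv \<tau> x)" and lt: "inv \<sigma> x < inv \<sigma> y"
        using xy by (auto simp: discordant_def inv\<tau>')
      \<comment> \<open>\<open>s\<close> reverses the order of the positions \<open>i\<close> and
        \<open>i + 1\<close> only, so a newly discordant pair could only be
        \<open>(\<tau> i, \<tau> (i + 1))\<close>, which \<open>inv \<sigma>\<close> orders the
        wrong way by \<open>gt\<close>.\<close>
      have "inv \<tau> y < inv \<tau> x"
      proof (rule ccontr)
        assume "\<not> inv \<tau> y < inv \<tau> x"
        then have "inv \<tau> y = i + 1 \<and> inv \<tau> x = i"
          using sxy by (auto simp: s_def transpose_def split: if_splits)
        then have "y = \<tau> (i + 1)" "x = \<tau> i" using inv\<tau>(2) by metis+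
        then show False using lt gt by simp
      qed
      then show "(x, y) \<in> ?D" using xy by (auto simp: discordant_def)
    qed
    ultimately have "card ?D' < card ?D"
      by (intro psubset_card_mono) auto
    then obtain k where k: "k \<le> card ?D'" "(\<tau>', \<sigma>) \<in> adjacent_swap n ^^ k"
      using less.hyps[OF _ \<tau>'] by blast
    have "(\<tau>, \<tau>') \<in> adjacent_swap n"
      using \<tau> i by (auto simp: adjacent_swap_def \<tau>'_def s_def)
    then have "(\<tau>, \<sigma>) \<in> adjacent_swap n ^^ Suc k"
      using k(2) by (rule relpow_Suc_I2)
    then show ?thesis using k(1) \<open>card ?D' < card ?D\<close> by (intro exI[of _ "Suc k"]) simp
  qed
qed

lemma kendall_dist_le_discordant:
  assumes "\<sigma> permutes {1..n}" and "\<tau> permutes {1..n}"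
  shows "kendall_dist n \<sigma> \<tau> \<le> card (discordant {1..n} (inv \<sigma>) (inv \<tau>))"
  using relpow_adjacent_swap_discordant[OF assms] unfolding kendall_dist_def
  by (meson Least_le le_trans)

section \<open>Plotkin bound\<close>

text \<open>A pair \<open>z\<close> is discordant for \<open>(p, q)\<close> exactly when
  \<open>p\<close> lies in \<open>?up z\<close> and \<open>q\<close> in \<open>?dn z\<close>. It is
  therefore counted \<open>card (?up z) * card (?dn z)\<close> times, which is at most a quarter of
  the square of \<open>card P\<close>.\<close>

lemma discordant_plotkin_bound:
  assumes A: "finite A" and P: "finite P"
    and d: "\<And>p q. p \<in> P \<Longrightarrow> q \<in> P \<Longrightarrow> p \<noteq> q \<Longrightarrow> d \<le> card (discordant A p q)"
  shows "4 * d * (card P * card P - card P) \<le> (card P)\<^sup>2 * (card A * card A - card A)"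
proof -
  let ?I = "A \<times> A - (\<lambda>x. (x, x)) ` A"
  let ?up = "\<lambda>z. {p \<in> P. p (fst z) < p (snd z)}"
  let ?dn = "\<lambda>z. {p \<in> P. p (snd z) < p (fst z)}"
  have offdiag: "card (B \<times> B - (\<lambda>x. (x, x)) ` B) = card B * card B - card B"
    if "finite B" for B :: "'c set"
    using that by (subst card_Diff_subset) (auto simp: card_cartesian_product card_image inj_on_def)
  \<comment> \<open>As a product of an indicator in \<open>p\<close> and one in \<open>q\<close>,
    the count factors once the sum over \<open>z\<close> is moved outside.\<close>
  have disc: "card (discordant A p q) =
      (\<Sum>z\<in>?I. of_bool (p (fst z) < p (snd z)) * of_bool (q (snd z) < q (fst z)))" for p q
  proof -
    have "discordant A p q = {z \<in> ?I. p (fst z) < p (snd z) \<and> q (snd z) < q (fst z)}"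
      by (auto simp: discordant_def)
    then show ?thesis using A
      by (simp add: Int_def flip: of_bool_conj)
  qed
  have prod: "4 * (card (?up z) * card (?dn z)) \<le> (card P)\<^sup>2" for z
  proof -
    have "card (?up z) + card (?dn z) = card (?up z \<union> ?dn z)"
      using P by (intro card_Un_disjoint[symmetric]) auto
    also have "\<dots> \<le> card P" using P by (intro card_mono) auto
    finally have le: "card (?up z) + card (?dn z) \<le> card P" .
    \<comment> \<open>AM-GM, proved over the integers because \<open>a - b\<close> would be
      truncated on \<open>nat\<close>.\<close>
    have "4 * (a * b) \<le> (a + b)\<^sup>2" for a b :: nat
    proof -
      have "0 \<le> (int a - int b)\<^sup>2" by simp
      then have "int (4 * (a * b)) \<le> int ((a + b)\<^sup>2)"
        by (simp add: power2_eq_square algebra_simps)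
      then show ?thesis by (simp only: of_nat_le_iff)
    qed
    from this[of "card (?up z)" "card (?dn z)"] show ?thesis
      using power_mono[OF le, of 2] by linarith
  qed
  have "d * (card P * card P - card P) = (\<Sum>(p, q)\<in>P \<times> P - (\<lambda>x. (x, x)) ` P. d)"
    using offdiag[OF P] by simp
  also have "\<dots> \<le> (\<Sum>(p, q)\<in>P \<times> P - (\<lambda>x. (x, x)) ` P. card (discordant A p q))"
    by (rule sum_mono) (use d in auto)
  also have "\<dots> \<le> (\<Sum>(p, q)\<in>P \<times> P. card (discordant A p q))"
    using P by (intro sum_mono2) auto
  also have "\<dots> = (\<Sum>p\<in>P. \<Sum>q\<in>P. card (discordant A p q))"
    by (simp add: sum.cartesian_product)
  also have "\<dots> = (\<Sum>p\<in>P. \<Sum>z\<in>?I. \<Sum>q\<in>P.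
      of_bool (p (fst z) < p (snd z)) * of_bool (q (snd z) < q (fst z)))"
    unfolding disc by (intro sum.cong refl sum.swap)
  also have "\<dots> = (\<Sum>z\<in>?I. \<Sum>p\<in>P. \<Sum>q\<in>P.
      of_bool (p (fst z) < p (snd z)) * of_bool (q (snd z) < q (fst z)))"
    by (rule sum.swap)
  also have "\<dots> = (\<Sum>z\<in>?I. card (?up z) * card (?dn z))"
    unfolding sum_product[symmetric] using P by (simp add: Int_def)
  finally have "4 * d * (card P * card P - card P) \<le> (\<Sum>z\<in>?I. 4 * (card (?up z) * card (?dn z)))"
    by (simp flip: sum_distrib_left)
  also have "\<dots> \<le> (\<Sum>z\<in>?I. (card P)\<^sup>2)"
    by (intro sum_mono prod)
  also have "\<dots> = (card P)\<^sup>2 * (card A * card A - card A)"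
    using offdiag[OF A] by simp
  finally show ?thesis .
qed

section \<open>The case \<open>t = 3\<close>\<close>

text \<open>The Plotkin bound holds here with equality, 16 on both sides, so it yields no
  contradiction and the extremal configuration has to be excluded by its structure.\<close>

lemma no_four_discordant_permutations:
  fixes P :: "(nat \<Rightarrow> nat) set"
  assumes P: "\<And>p. p \<in> P \<Longrightarrow> p permutes {1..4}" and card: "card P = 4"
    and d: "\<And>p q. p \<in> P \<Longrightarrow> q \<in> P \<Longrightarrow> p \<noteq> q \<Longrightarrow> 4 \<le> card (discordant {1..4} p q)"
  shows False
proof -
  obtain g q r s where g: "P = {g, q, r, s}" and dist: "distinct [g, q, r, s]"
    using card by (auto simp: card_Suc_eq numeral_eq_Suc)
  let ?A = "{1..4} :: nat set"
  \<comment> \<open>\<open>g\<close> is the reference: \<open>L\<close> holds the six pairs oriented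
    as \<open>g\<close> orders them, and \<open>N p\<close> those on which \<open>p\<close> agrees
    with \<open>g\<close>.\<close>
  define L where "L = {(x, y) \<in> ?A \<times> ?A. g x < g y}"
  define N where "N p = {(x, y) \<in> L. p x < p y}" for p :: "nat \<Rightarrow> nat"
  have inj: "p x = p y \<longleftrightarrow> x = y" if "p \<in> P" for p x y
    using permutes_inj[OF P[OF that]] by (auto dest: injD)
  have "\<exists>x\<in>?A. g x = i" if "i \<in> ?A" for i
    using permutes_image[OF P[of g]] g that by (metis imageE insertI1)
  from this[of 1] this[of 2] this[of 3] this[of 4] obtain a b c e
    where mem: "{a, b, c, e} \<subseteq> ?A" and val: "g a = 1" "g b = 2" "g c = 3" "g e = 4"
    by auto
  have ne: "distinct [a, b, c, e]" using val by auto
  have A: "?A = {a, b, c, e}"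
    by (rule card_subset_eq[symmetric]) (use mem ne in auto)
  have L_eq: "L = {(a, b), (a, c), (a, e), (b, c), (b, e), (c, e)}"
    unfolding L_def A using val by auto
  have L: "card L = 6" unfolding L_eq using ne by auto
  have finL [simp]: "finite L" by (simp add: L_eq)
  have finN [simp]: "finite (N p)" for p
    by (rule finite_subset[OF _ finL]) (auto simp: N_def)
  have Nle: "card (N p) \<le> 2" if "p \<in> P" "p \<noteq> g" for p
  proof -
    have "L = N p \<union> discordant ?A g p" "N p \<inter> discordant ?A g p = {}"
      using inj[OF that(1)]
      by (auto simp: L_def N_def discordant_def) (metis less_irrefl linorder_neqE_nat)
    then have "card L = card (N p) + card (discordant ?A g p)"
      using card_Un_disjoint[of "N p" "discordant ?A g p"] by simp
    then show ?thesis using d[of g p] that g L by auto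
  qed
  have N2: "card (N p) = 2 \<and> N p \<inter> N p' = {}"
    if p: "p \<in> P" "p \<noteq> g" and p': "p' \<in> P" "p' \<noteq> g" and "p \<noteq> p'" for p p'
  proof -
    \<comment> \<open>Disagreements of \<open>p\<close> and \<open>p'\<close> embed into the
      symmetric difference of \<open>N p\<close> and \<open>N p'\<close>. With both sets of size at
      most 2, four disagreements force size 2 and disjointness.\<close>
    have "discordant ?A p p' \<subseteq> (N p - N p') \<union> prod.swap ` (N p' - N p)"
    proof clarify
      fix x y assume xy: "(x, y) \<in> discordant ?A p p'" "(x, y) \<notin> prod.swap ` (N p' - N p)"
      have "(y, x) \<notin> N p' - N p" using xy(2) by force
      moreover have "g x \<noteq> g y" using xy(1) inj[of g] g by (auto simp: discordant_def)
      ultimately show "(x, y) \<in> N p - N p'"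
        using xy(1) by (auto simp: discordant_def N_def L_def)
    qed
    then have "card (discordant ?A p p') \<le> card ((N p - N p') \<union> prod.swap ` (N p' - N p))"
      by (intro card_mono) auto
    also have "\<dots> \<le> card (N p - N p') + card (N p' - N p)"
      by (intro order_trans[OF card_Un_le] add_left_mono card_image_le) simp
    also have "\<dots> = (card (N p) - card (N p \<inter> N p')) + (card (N p') - card (N p \<inter> N p'))"
      by (simp add: card_Diff_subset_Int Int_commute)
    finally have "4 \<le> (card (N p) - card (N p \<inter> N p')) + (card (N p') - card (N p \<inter> N p'))"
      using d[OF p(1) p'(1) \<open>p \<noteq> p'\<close>] by simp
    then have "card (N p) = 2" "card (N p \<inter> N p') = 0"
      using Nle[OF p] Nle[OF p'] by linarith+
    then show ?thesis by simp
  qed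
  have not_mem: "(a, e) \<notin> N p" if "p \<in> P" "p \<noteq> g" for p
  proof
    assume ae: "(a, e) \<in> N p"
    \<comment> \<open>Otherwise \<open>p e \<le> p w \<le> p a\<close>, against
      \<open>p a < p e\<close>. The choices \<open>w = b\<close> and \<open>w = c\<close> give
      different pairs, hence three elements of \<open>N p\<close>.\<close>
    then have "(a, w) \<in> N p \<or> (w, e) \<in> N p" if "w \<in> {b, c}" for w
      using that by (auto simp: N_def L_eq)
    then obtain U V where "U \<in> {(a, b), (b, e)}" "U \<in> N p" "V \<in> {(a, c), (c, e)}" "V \<in> N p"
      by blast
    then have "{(a, e), U, V} \<subseteq> N p" "card {(a, e), U, V} = 3"
      using ae ne by auto
    then have "3 \<le> card (N p)" by (metis card_mono finN)
    then show False using Nle[OF that] by simp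
  qed
  have "card (N q \<union> N r \<union> N s) = card (N q) + card (N r) + card (N s)"
    using N2[of q r] N2[of q s] N2[of r s] g dist
    by (subst card_Un_disjoint; (subst card_Un_disjoint)?) auto
  also have "\<dots> = card L"
    using N2[of q r] N2[of r s] N2[of s q] g dist by (auto simp: L)
  finally have "N q \<union> N r \<union> N s = L"
    by (intro card_subset_eq) (auto simp: N_def)
  moreover have "(a, e) \<in> L" by (simp add: L_eq)
  ultimately show False using not_mem g dist by auto
qed

section \<open>Averaging over cosets\<close>

text \<open>Right multiplication by \<open>\<pi>\<close> is a bijection from \<open>C\<close> onto
  this set.\<close>

lemma card_permutes_comp_inv_mem:
  assumes \<pi>: "\<pi> permutes S" and C: "C \<subseteq> {\<sigma>. \<sigma> permutes S}"
  shows "card {\<rho>. \<rho> permutes S \<and> \<rho> \<circ> inv \<pi> \<in> C} = card C"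
proof -
  have 1: "(c \<circ> \<pi>) \<circ> inv \<pi> = c" "(c \<circ> inv \<pi>) \<circ> \<pi> = c" for c :: "'a \<Rightarrow> 'a"
    using permutes_inv_o[OF \<pi>] by (simp_all add: comp_assoc)
  have "{\<rho>. \<rho> permutes S \<and> \<rho> \<circ> inv \<pi> \<in> C} = (\<lambda>c. c \<circ> \<pi>) ` C"
  proof (intro equalityI subsetI)
    fix \<rho> assume "\<rho> \<in> {\<rho>. \<rho> permutes S \<and> \<rho> \<circ> inv \<pi> \<in> C}"
    then show "\<rho> \<in> (\<lambda>c. c \<circ> \<pi>) ` C"
      by (intro image_eqI[of _ _ "\<rho> \<circ> inv \<pi>"]) (auto simp: 1)
  qed (use C in \<open>auto simp: 1 intro: permutes_compose[OF \<pi>]\<close>)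
  moreover have "inj_on (\<lambda>c. c \<circ> \<pi>) C"
    by (rule inj_on_inverseI[of _ "\<lambda>c. c \<circ> inv \<pi>"]) (rule 1)
  ultimately show ?thesis by (simp add: card_image)
qed

text \<open>Count the pairs \<open>(\<pi>, \<rho>)\<close> with
  \<open>\<rho> \<circ> inv \<pi> \<in> C\<close>: every \<open>\<pi>\<close> occurs
  \<open>card C\<close> times, so some \<open>\<rho>\<close> occurs at least the average number of
  times, which is at least \<open>k\<close>.\<close>

lemma coset_pigeonhole:
  assumes S: "finite S" and "T \<subseteq> S" and C: "C \<subseteq> {\<sigma>. \<sigma> permutes S}"
    and k: "k * fact (card S) \<le> card C * fact (card T)"
  obtains \<rho> P where "\<rho> permutes S" "P \<subseteq> {\<pi>. \<pi> permutes T}" "card P = k"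
    "\<And>\<pi>. \<pi> \<in> P \<Longrightarrow> \<rho> \<circ> inv \<pi> \<in> C"
proof -
  let ?F = "\<lambda>\<rho>. {\<pi>. \<pi> permutes T \<and> \<rho> \<circ> inv \<pi> \<in> C}"
  let ?S = "{\<sigma>. \<sigma> permutes S}" and ?T = "{\<pi>. \<pi> permutes T}"
  have T: "finite T" using assms finite_subset by blast
  have fin: "finite ?S" "finite ?T" using S T by (simp_all add: finite_permutations)
  have "\<exists>\<rho>\<in>?S. k \<le> card (?F \<rho>)"
  proof (rule ccontr)
    assume "\<not> ?thesis"
    then have less: "card (?F \<rho>) < k" if "\<rho> \<in> ?S" for \<rho> using that by force
    have "card C * fact (card T) = (\<Sum>\<pi>\<in>?T. card {\<rho>. \<rho> permutes S \<and> \<rho> \<circ> inv \<pi> \<in> C})"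
      using card_permutes_comp_inv_mem[OF permutes_subset[OF _ \<open>T \<subseteq> S\<close>] C]
      by (simp add: card_permutations[OF refl T])
    also have "\<dots> = (\<Sum>\<pi>\<in>?T. \<Sum>\<rho>\<in>?S. of_bool (\<rho> \<circ> inv \<pi> \<in> C))"
      using fin by (simp add: Int_def)
    also have "\<dots> = (\<Sum>\<rho>\<in>?S. \<Sum>\<pi>\<in>?T. of_bool (\<rho> \<circ> inv \<pi> \<in> C))"
      by (rule sum.swap)
    also have "\<dots> = (\<Sum>\<rho>\<in>?S. card (?F \<rho>))"
      using fin by (simp add: Int_def)
    also have "\<dots> < (\<Sum>\<rho>\<in>?S. k)"
      using fin less permutes_id by (intro sum_strict_mono) blast+
    also have "\<dots> = k * fact (card S)"
      by (simp add: card_permutations[OF refl S])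
    finally show False using k by simp
  qed
  then obtain \<rho> where \<rho>: "\<rho> permutes S" "k \<le> card (?F \<rho>)" by blast
  obtain P where "P \<subseteq> ?F \<rho>" "card P = k"
    by (rule obtain_subset_with_card_n[OF \<rho>(2)])
  then show thesis using \<rho>(1) by (intro that[of \<rho> P]) auto
qed

text \<open>The word \<open>\<rho> \<circ> inv p\<close> has the entry \<open>\<rho> z\<close> at
  position \<open>p z\<close>, so \<open>\<rho>\<close> merely relabels entries. Beyond
  \<open>m\<close> both \<open>p\<close> and \<open>q\<close> are the identity, so a pair reaching
  beyond \<open>m\<close> is ordered alike by both.\<close>

lemma card_discordant_coset_le:
  fixes n m :: nat
  assumes \<rho>: "\<rho> permutes {1..n}" and p: "p permutes {1..m}" and q: "q permutes {1..m}"
  shows "card (discordant {1..n} (inv (\<rho> \<circ> inv p)) (inv (\<rho> \<circ> inv q))) \<le> card (discordant {1..m} p q)"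
proof -
  have inv: "inv (\<rho> \<circ> inv p) x = p (inv \<rho> x)" if "p permutes {1..m}" for p x
    using permutes_bij[OF \<rho>] permutes_bij[OF permutes_inv[OF that]] permutes_inv_inv[OF that]
    by (simp add: o_inv_distrib)
  have "discordant {1..n} (inv (\<rho> \<circ> inv p)) (inv (\<rho> \<circ> inv q)) \<subseteq> map_prod \<rho> \<rho> ` discordant {1..m} p q"
  proof clarify
    fix x y assume "(x, y) \<in> discordant {1..n} (inv (\<rho> \<circ> inv p)) (inv (\<rho> \<circ> inv q))"
    then have xy: "x \<in> {1..n}" "y \<in> {1..n}" "p (inv \<rho> x) < p (inv \<rho> y)" "q (inv \<rho> y) < q (inv \<rho> x)"
      by (auto simp: discordant_def inv[OF p] inv[OF q])
    have in_m: "p z \<le> m \<longleftrightarrow> z \<le> m" if "p permutes {1..m}" "z \<in> {1..n}" for p z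
      using permutes_in_image[OF that(1), of z] permutes_not_in[OF that(1), of z] that(2)
      by (cases "z \<le> m") auto
    have fixed: "p z = z" if "p permutes {1..m}" "\<not> z \<le> m" for p z
      using permutes_not_in[OF that(1), of z] that(2) by auto
    have mem: "inv \<rho> x \<in> {1..n}" "inv \<rho> y \<in> {1..n}"
      using xy permutes_in_image[OF permutes_inv[OF \<rho>]] by auto
    have "inv \<rho> x \<le> m \<and> inv \<rho> y \<le> m"
      using xy(3,4) in_m[OF p mem(1)] in_m[OF p mem(2)] in_m[OF q mem(1)] in_m[OF q mem(2)]
        fixed[OF p, of "inv \<rho> x"] fixed[OF p, of "inv \<rho> y"]
        fixed[OF q, of "inv \<rho> x"] fixed[OF q, of "inv \<rho> y"]
      by auto
    with mem have "(inv \<rho> x, inv \<rho> y) \<in> discordant {1..m} p q"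
      using xy by (auto simp: discordant_def)
    then show "(x, y) \<in> map_prod \<rho> \<rho> ` discordant {1..m} p q"
      by (rule rev_image_eqI) (simp add: permutes_inverses[OF \<rho>])
  qed
  then have "card (discordant {1..n} (inv (\<rho> \<circ> inv p)) (inv (\<rho> \<circ> inv q)))
      \<le> card (map_prod \<rho> \<rho> ` discordant {1..m} p q)"
    by (intro card_mono) auto
  also have "\<dots> \<le> card (discordant {1..m} p q)"
    by (rule card_image_le) simp
  finally show ?thesis .
qed

section \<open>Nonexistence of balanced codes\<close>

lemma kendall_min_dist_le:
  assumes "finite C" "\<sigma> \<in> C" "\<tau> \<in> C" "\<sigma> \<noteq> \<tau>"
  shows "kendall_min_dist n C \<le> kendall_dist n \<sigma> \<tau>"
  unfolding kendall_min_dist_def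
proof (rule Min_le)
  show "finite {kendall_dist n \<sigma> \<tau> |\<sigma> \<tau>. \<sigma> \<in> C \<and> \<tau> \<in> C \<and> \<sigma> \<noteq> \<tau>}"
    by (rule finite_subset[of _ "(\<lambda>(\<sigma>, \<tau>). kendall_dist n \<sigma> \<tau>) ` (C \<times> C)"]) (use assms in auto)
qed (use assms in auto)

theorem theorem4p5:
  fixes n t :: nat
  assumes "n > 0" and "3 \<le> t" and "t \<le> n"
  shows "\<not> (\<exists>C. balanced_code n t C)"
proof
  assume "\<exists>C. balanced_code n t C"
  then obtain C where C: "C \<subseteq> {\<sigma>. \<sigma> permutes {1..n}}" "card C \<ge> 2"
    and far: "kendall_min_dist n C > t choose 2" and size: "real (card C) = fact n / fact t"
    by (auto simp: balanced_code_def permutation_code_def)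
  have finC: "finite C" using C(2) by (intro card_ge_0_finite) simp
  \<comment> \<open>For \<open>t = n\<close> the code would have a single word. Excluding this
    leaves room for \<open>t + 1\<close> positions.\<close>
  have "t \<noteq> n" using size C(2) by auto
  then have tn: "Suc t \<le> n" using assms by simp
  have "real (card C * fact t) = real (fact n)" using size by simp
  then have "card C * fact t = fact n" by (simp only: of_nat_eq_iff)
  \<comment> \<open>Multiplying the size equation by \<open>t + 1\<close> shows that a coset
    contains \<open>t + 1\<close> codewords on average.\<close>
  then have "Suc t * fact (card {1..n}) \<le> card C * fact (card {1..Suc t})"
    by (simp add: algebra_simps)
  then obtain \<rho> P where \<rho>: "\<rho> permutes {1..n}" and P: "P \<subseteq> {\<pi>. \<pi> permutes {1..Suc t}}"
    and cardP: "card P = Suc t" and PC: "\<And>\<pi>. \<pi> \<in> P \<Longrightarrow> \<rho> \<circ> inv \<pi> \<in> C"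
    using coset_pigeonhole[OF _ _ C(1), of "{1..Suc t}" "Suc t"] tn
    by (metis atLeastatMost_subset_iff finite_atLeastAtMost order_refl)
  have d: "Suc (t choose 2) \<le> card (discordant {1..Suc t} p q)"
    if "p \<in> P" "q \<in> P" "p \<noteq> q" for p q
  proof -
    have pq: "p permutes {1..Suc t}" "q permutes {1..Suc t}" using P that by auto
    have "\<rho> \<circ> inv p \<noteq> \<rho> \<circ> inv q"
    proof
      assume "\<rho> \<circ> inv p = \<rho> \<circ> inv q"
      then have "inv p = inv q"
        using permutes_inj[OF \<rho>] by (auto simp: fun_eq_iff dest: injD)
      then show False using pq that(3) permutes_inv_inv by metis
    qed
    then have "kendall_min_dist n C \<le> kendall_dist n (\<rho> \<circ> inv p) (\<rho> \<circ> inv q)"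
      using kendall_min_dist_le[OF finC PC PC] that by blast
    also have "\<dots> \<le> card (discordant {1..n} (inv (\<rho> \<circ> inv p)) (inv (\<rho> \<circ> inv q)))"
      using kendall_dist_le_discordant PC that C(1) by blast
    also have "\<dots> \<le> card (discordant {1..Suc t} p q)"
      by (rule card_discordant_coset_le[OF \<rho> pq])
    finally show ?thesis using far by simp
  qed
  show False
  proof (cases "t = 3")
    case True
    show False
    proof (rule no_four_discordant_permutations)
      show "card P = 4" using cardP True by simp
      show "p permutes {1..4}" if "p \<in> P" for p using P that True by auto
      show "4 \<le> card (discordant {1..4} p q)" if "p \<in> P" "q \<in> P" "p \<noteq> q" for p q
        using d[OF that] True by (simp add: choose_two)
    qed
  next
    case False
    have "finite P" using cardP by (intro card_ge_0_finite) simp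
    then have "4 * Suc (t choose 2) * (Suc t * Suc t - Suc t) \<le> (Suc t)\<^sup>2 * (Suc t * Suc t - Suc t)"
      using discordant_plotkin_bound[OF _ _ d, of P] cardP by simp
    \<comment> \<open>There are as many permutations in \<open>P\<close> as positions, so the same
      factor stands on both sides of the Plotkin bound and cancels.\<close>
    moreover have "Suc t * Suc t - Suc t > 0" using assms by simp
    ultimately have "4 * Suc (t choose 2) \<le> (Suc t)\<^sup>2" by simp
    moreover have "2 * (t choose 2) = t * (t - 1)"
      unfolding choose_two by (rule dvd_mult_div_cancel) (cases t; simp)
    \<comment> \<open>This amounts to \<open>(t - 1) * (t - 3) \<le> 0\<close>, which fails from
      \<open>t = 4\<close> on; writing \<open>t = 4 + u\<close> avoids truncated
      subtraction.\<close>
    ultimately have "2 * (t * (t - 1)) + 4 \<le> (Suc t)\<^sup>2" by simp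
    moreover have "4 \<le> t" using assms False by simp
    then obtain u where "t = 4 + u" using le_Suc_ex by blast
    ultimately show False by (simp add: power2_eq_square algebra_simps)
  qed
qed

end
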